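(* Let $(\mathcal C,\square,e,\alpha,\lambda,\rho,\tau,\gamma)$ be a symmetric monoidal category in the sense of the context, i.e. satisfying the five coherence conditions (C1)–(C5). Then these five conditions imply that all critical branchings between the natural transformations $\alpha,\lambda,\rho,\tau,\gamma$ are coherent; that is, besides (C1)–(C5), the following identities hold for all objects $x,y,z,t$ of $\mathcal C$ (writing $1$ for identities and $xy$ for $x\square y$): (K1) $\lambda_{xy}\circ\alpha_{e,x,y}=\lambda_x\square1_y$; (K2) $(1_x\square\rho_y)\circ\alpha_{x,y,e}=\rho_{xy}$; (K3) $\lambda_e=\rho_e$; (K4) $(1\square\alpha_{x,z,t})\circ\alpha_{y,xz,t}\circ(\gamma_{x,y,z}\square1_t)=\gamma_{x,y,zt}\circ(1\square\alpha_{y,z,t})\circ\alpha_{x,yz,t}$; (K5) $(1_y\square\rho_x)\circ\gamma_{x,y,e}=\tau_{x,y}\circ(1_x\square\rho_y)$; (W1) $\rho_x\circ\tau_{e,x}=\lambda_x$; (W2) $\lambda_x\circ\tau_{x,e}=\rho_x$; (W3) $\lambda_{xy}\circ\gamma_{x,e,y}=1_x\square\lambda_y$; (W4) $(1_x\square\lambda_y)\circ\gamma_{e,x,y}=\lambda_{xy}$; (W5) $\gamma_{y,x,z}\circ\gamma_{x,y,z}=1$; (W6) $\gamma_{y,x,z}\circ\tau_{xz,y}=(1_x\square\tau_{z,y})\circ\alpha_{x,z,y}$; (W7) $\alpha_{x,y,zt}\circ\gamma_{z,xy,t}=(1_x\square\gamma_{z,y,t})\circ\gamma_{z,x,yt}\circ(1_z\square\alpha_{x,y,t})$;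 (W8) $\gamma_{y,x,zt}\circ(1_y\square\alpha_{x,z,t})\circ\gamma_{xz,y,t}=(1_x\square\gamma_{z,y,t})\circ\alpha_{x,z,yt}$; (W9) $\gamma_{y,x,z}\circ(1_y\square\tau_{z,x})\circ\gamma_{z,y,x}=(1_x\square\tau_{z,y})\circ\gamma_{z,x,y}\circ(1_z\square\tau_{y,x})$; (W10) $\gamma_{y,x,zt}\circ(1_y\square\gamma_{z,x,t})\circ\gamma_{z,y,xt}=(1_x\square\gamma_{z,y,t})\circ\gamma_{z,x,yt}\circ(1_z\square\gamma_{y,x,t})$; (W11) $\gamma_{y,x,z}\circ(1_y\square\tau_{z,x})\circ\alpha_{y,z,x}=\tau_{yz,x}$; (W12) $\gamma_{y,x,zt}\circ(1_y\square\gamma_{z,x,t})\circ\alpha_{y,z,xt}=(1_x\square\alpha_{y,z,t})\circ\gamma_{yz,x,t}$.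
   Context: In this statement a symmetric monoidal category is a category $\mathcal C$ with a bifunctor $\square:\mathcal C\times\mathcal C\to\mathcal C$, an object $e$, and natural isomorphisms $\alpha_{xyz}:(x\square y)\square z\to x\square(y\square z)$, $\lambda_x:e\square x\to x$, $\rho_x:x\square e\to x$, $\tau_{xy}:x\square y\to y\square x$ (braiding) and $\gamma_{xyz}:x\square(y\square z)\to y\square(x\square z)$ (parallel associativity), satisfying the five coherence conditions, for all objects $x,y,z,t$: (C1) $(\mathrm{id}\square\alpha_{y,z,t})\circ\alpha_{x,y\square z,t}\circ(\alpha_{x,y,z}\square\mathrm{id})=\alpha_{x,y,z\square t}\circ\alpha_{x\square y,z,t}$; (C2) $(\mathrm{id}_x\square\lambda_y)\circ\alpha_{x,e,y}=\rho_x\square\mathrm{id}_y$; (C3) $\tau_{y,x}\circ\tau_{x,y}=\mathrm{id}_{x\square y}$; (C4) $\gamma_{x,y,z}\circ\alpha_{x,y,z}=\alpha_{y,x,z}\circ(\tau_{x,y}\square\mathrm{id}_z)$; (C5) $(\mathrm{id}_y\square\tau_{x,z})\circ\gamma_{x,y,z}=\alpha_{y,z,x}\circ\tau_{x,y\square z}$. *)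

theory Defs
  imports Main
begin

text \<open>Composition is written in the usual order (\<open>g \<cdot> f\<close> is \<open>g\<close> after \<open>f\<close>); it is
  a total HOL function on which nothing is assumed for non-composable arguments.\<close>

record ('o, 'm) cat =
  Obj :: "'o set"
  Arr :: "'m set"
  Dom :: "'m \<Rightarrow> 'o"
  Cod :: "'m \<Rightarrow> 'o"
  ident :: "'o \<Rightarrow> 'm"  (\<open>\<one>\<index>\<close>)
  comp :: "'m \<Rightarrow> 'm \<Rightarrow> 'm"  (infixl \<open>\<cdot>\<index>\<close> 55)

definition hom :: "('o, 'm) cat \<Rightarrow> 'o \<Rightarrow> 'o \<Rightarrow> 'm set" where
  "hom C x y = {f \<in> Arr C. Dom C f = x \<and> Cod C f = y}"

locale category =
  fixes C :: "('o, 'm) cat" (structure)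
  assumes dom_obj: "f \<in> Arr C \<Longrightarrow> Dom C f \<in> Obj C"
    and cod_obj: "f \<in> Arr C \<Longrightarrow> Cod C f \<in> Obj C"
    and ident_hom: "x \<in> Obj C \<Longrightarrow> \<one> x \<in> hom C x x"
    and comp_hom: "f \<in> hom C x y \<Longrightarrow> g \<in> hom C y z \<Longrightarrow> g \<cdot> f \<in> hom C x z"
    and ident_right: "f \<in> hom C x y \<Longrightarrow> f \<cdot> \<one> x = f"
    and ident_left: "f \<in> hom C x y \<Longrightarrow> \<one> y \<cdot> f = f"
    and comp_assoc: "f \<in> hom C x y \<Longrightarrow> g \<in> hom C y z \<Longrightarrow> h \<in> hom C z w \<Longrightarrow>
                       (h \<cdot> g) \<cdot> f = h \<cdot> (g \<cdot> f)"

definition iso :: "('o, 'm) cat \<Rightarrow> 'm \<Rightarrow> bool" where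
  "iso C f \<longleftrightarrow> f \<in> Arr C \<and>
     (\<exists>g \<in> hom C (Cod C f) (Dom C f).
        g \<cdot>\<^bsub>C\<^esub> f = \<one>\<^bsub>C\<^esub> (Dom C f) \<and> f \<cdot>\<^bsub>C\<^esub> g = \<one>\<^bsub>C\<^esub> (Cod C f))"

definition prod_cat :: "('o, 'm) cat \<Rightarrow> ('p, 'n) cat \<Rightarrow> ('o \<times> 'p, 'm \<times> 'n) cat"
    (infixr \<open>\<times>\<^sub>C\<close> 80) where
  "A \<times>\<^sub>C B =
     \<lparr>Obj = Obj A \<times> Obj B,
      Arr = Arr A \<times> Arr B,
      Dom = (\<lambda>(f, g). (Dom A f, Dom B g)),
      Cod = (\<lambda>(f, g). (Cod A f, Cod B g)),
      ident = (\<lambda>(x, y). (\<one>\<^bsub>A\<^esub> x, \<one>\<^bsub>B\<^esub> y)),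
      comp = (\<lambda>(f', g') (f, g). (f' \<cdot>\<^bsub>A\<^esub> f, g' \<cdot>\<^bsub>B\<^esub> g))\<rparr>"

record ('o, 'm, 'p, 'n) ftr =
  omap :: "'o \<Rightarrow> 'p"
  amap :: "'m \<Rightarrow> 'n"

locale cat_functor = A: category A + B: category B
  for A :: "('o, 'm) cat" and B :: "('p, 'n) cat" +
  fixes F :: "('o, 'm, 'p, 'n) ftr"
  assumes omap_obj: "x \<in> Obj A \<Longrightarrow> omap F x \<in> Obj B"
    and amap_hom: "f \<in> hom A x y \<Longrightarrow> amap F f \<in> hom B (omap F x) (omap F y)"
    and amap_ident: "x \<in> Obj A \<Longrightarrow> amap F (\<one>\<^bsub>A\<^esub> x) = \<one>\<^bsub>B\<^esub> (omap F x)"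
    and amap_comp: "f \<in> hom A x y \<Longrightarrow> g \<in> hom A y z \<Longrightarrow>
                      amap F (g \<cdot>\<^bsub>A\<^esub> f) = amap F g \<cdot>\<^bsub>B\<^esub> amap F f"

locale natural_transformation = F: cat_functor A B F + G: cat_functor A B G
  for A :: "('o, 'm) cat" and B :: "('p, 'n) cat"
    and F :: "('o, 'm, 'p, 'n) ftr" and G :: "('o, 'm, 'p, 'n) ftr" +
  fixes \<eta> :: "'o \<Rightarrow> 'n"
  assumes component_hom: "x \<in> Obj A \<Longrightarrow> \<eta> x \<in> hom B (omap F x) (omap G x)"
    and naturality: "f \<in> hom A x y \<Longrightarrow>
                       amap G f \<cdot>\<^bsub>B\<^esub> \<eta> x = \<eta> y \<cdot>\<^bsub>B\<^esub> amap F f"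

locale natural_isomorphism = natural_transformation +
  assumes component_iso: "x \<in> Obj A \<Longrightarrow> iso B (\<eta> x)"

locale symmetric_monoidal_category = category C
  for C :: "('o, 'm) cat" (structure) +
  fixes box_obj :: "'o \<Rightarrow> 'o \<Rightarrow> 'o"  (infixr \<open>\<box>\<close> 70)
    and box_arr :: "'m \<Rightarrow> 'm \<Rightarrow> 'm"  (infixr \<open>\<box>\<^sub>m\<close> 70)
    and e :: 'o
    and \<alpha> :: "'o \<Rightarrow> 'o \<Rightarrow> 'o \<Rightarrow> 'm"
    and lam :: "'o \<Rightarrow> 'm"
    and \<rho> :: "'o \<Rightarrow> 'm"
    and \<tau> :: "'o \<Rightarrow> 'o \<Rightarrow> 'm"
    and \<gamma> :: "'o \<Rightarrow> 'o \<Rightarrow> 'o \<Rightarrow> 'm"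
  assumes bifunctor:
      "cat_functor (C \<times>\<^sub>C C) C
         \<lparr>omap = \<lambda>(x, y). x \<box> y, amap = \<lambda>(f, g). f \<box>\<^sub>m g\<rparr>"
    and unit_obj: "e \<in> Obj C"
    and associator:
      "natural_isomorphism (C \<times>\<^sub>C C \<times>\<^sub>C C) C
         \<lparr>omap = \<lambda>(x, y, z). (x \<box> y) \<box> z, amap = \<lambda>(f, g, h). (f \<box>\<^sub>m g) \<box>\<^sub>m h\<rparr>
         \<lparr>omap = \<lambda>(x, y, z). x \<box> (y \<box> z), amap = \<lambda>(f, g, h). f \<box>\<^sub>m (g \<box>\<^sub>m h)\<rparr>
         (\<lambda>(x, y, z). \<alpha> x y z)"
    and left_unitor:
      "natural_isomorphism C C
         \<lparr>omap = \<lambda>x. e \<box> x, amap = \<lambda>f. \<one> e \<box>\<^sub>m f\<rparr>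
         \<lparr>omap = \<lambda>x. x, amap = \<lambda>f. f\<rparr>
         lam"
    and right_unitor:
      "natural_isomorphism C C
         \<lparr>omap = \<lambda>x. x \<box> e, amap = \<lambda>f. f \<box>\<^sub>m \<one> e\<rparr>
         \<lparr>omap = \<lambda>x. x, amap = \<lambda>f. f\<rparr>
         \<rho>"
    and braiding:
      "natural_isomorphism (C \<times>\<^sub>C C) C
         \<lparr>omap = \<lambda>(x, y). x \<box> y, amap = \<lambda>(f, g). f \<box>\<^sub>m g\<rparr>
         \<lparr>omap = \<lambda>(x, y). y \<box> x, amap = \<lambda>(f, g). g \<box>\<^sub>m f\<rparr>
         (\<lambda>(x, y). \<tau> x y)"
    and parallel_associator:
      "natural_isomorphism (C \<times>\<^sub>C C \<times>\<^sub>C C) C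
         \<lparr>omap = \<lambda>(x, y, z). x \<box> (y \<box> z), amap = \<lambda>(f, g, h). f \<box>\<^sub>m (g \<box>\<^sub>m h)\<rparr>
         \<lparr>omap = \<lambda>(x, y, z). y \<box> (x \<box> z), amap = \<lambda>(f, g, h). g \<box>\<^sub>m (f \<box>\<^sub>m h)\<rparr>
         (\<lambda>(x, y, z). \<gamma> x y z)"
    and C1: "x \<in> Obj C \<Longrightarrow> y \<in> Obj C \<Longrightarrow> z \<in> Obj C \<Longrightarrow> t \<in> Obj C \<Longrightarrow>
      (\<one> x \<box>\<^sub>m \<alpha> y z t) \<cdot> \<alpha> x (y \<box> z) t \<cdot> (\<alpha> x y z \<box>\<^sub>m \<one> t)
        = \<alpha> x y (z \<box> t) \<cdot> \<alpha> (x \<box> y) z t"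
    and C2: "x \<in> Obj C \<Longrightarrow> y \<in> Obj C \<Longrightarrow>
      (\<one> x \<box>\<^sub>m lam y) \<cdot> \<alpha> x e y = \<rho> x \<box>\<^sub>m \<one> y"
    and C3: "x \<in> Obj C \<Longrightarrow> y \<in> Obj C \<Longrightarrow> \<tau> y x \<cdot> \<tau> x y = \<one> (x \<box> y)"
    and C4: "x \<in> Obj C \<Longrightarrow> y \<in> Obj C \<Longrightarrow> z \<in> Obj C \<Longrightarrow>
      \<gamma> x y z \<cdot> \<alpha> x y z = \<alpha> y x z \<cdot> (\<tau> x y \<box>\<^sub>m \<one> z)"
    and C5: "x \<in> Obj C \<Longrightarrow> y \<in> Obj C \<Longrightarrow> z \<in> Obj C \<Longrightarrow>
      (\<one> y \<box>\<^sub>m \<tau> x z) \<cdot> \<gamma> x y z = \<alpha> y z x \<cdot> \<tau> x (y \<box> z)"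

end

theory Submission
  imports Defs
begin

text \<open>As all structure maps are isomorphisms, an identity may be checked after composing with one of
  them. Kelly's argument derives (K1)--(K3) from the pentagon (C1), the triangle (C2) and faithfulness
  of \<open>e \<box> -\<close> and \<open>- \<box> e\<close>. By (C4), \<open>\<gamma>\<close> is the braiding conjugated by \<open>\<alpha>\<close>, so (C5) is the hexagon;
  applied to \<open>x, e, y\<close> and combined with (K1) it gives (W3), hence the other unit identities.
  Precomposing (K4) with \<open>\<alpha> \<box> 1\<close> reduces it to the pentagon, and (W12) follows from (K4) together with
  (W11), the inverse of the hexagon. Finally (W7) and (W8) are (W12) with some \<open>\<gamma>\<close> inverted by (W5), and
  the Yang--Baxter identities (W9) and (W10) are naturality of \<open>\<tau>\<close> and \<open>\<gamma>\<close> in a braiding.\<close>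

section \<open>Composition calculus and cancellation of isomorphisms in a category\<close>

context category
begin

lemma homD:
  assumes "f \<in> hom C x y"
  shows "f \<in> Arr C" "Dom C f = x" "Cod C f = y"
  using assms by (auto simp: hom_def)

lemma homI: "f \<in> Arr C \<Longrightarrow> f \<in> hom C (Dom C f) (Cod C f)"
  by (simp add: hom_def)

declare dom_obj [simp] cod_obj [simp]

lemma ident_simps [simp]:
  assumes "x \<in> Obj C"
  shows "\<one> x \<in> Arr C" "Dom C (\<one> x) = x" "Cod C (\<one> x) = x"
  using homD [OF ident_hom [OF assms]] .

text \<open>Typing is phrased with \<open>Arr\<close>, \<open>Dom\<close> and \<open>Cod\<close>
  rather than \<open>hom\<close>: the simplifier can then compute the endpoints of a composite and
  discharge the side conditions of each rewrite.\<close>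

lemma comp_simps [simp]:
  assumes "f \<in> Arr C" "g \<in> Arr C" "Cod C f = Dom C g"
  shows "g \<cdot> f \<in> Arr C" "Dom C (g \<cdot> f) = Dom C f" "Cod C (g \<cdot> f) = Cod C g"
  using homD [OF comp_hom [OF homI homI [of g, folded assms(3)]]] assms by simp_all

lemma comp_ident [simp]: "f \<in> Arr C \<Longrightarrow> Dom C f = x \<Longrightarrow> f \<cdot> \<one> x = f"
  using ident_right homI by blast

lemma ident_comp [simp]: "f \<in> Arr C \<Longrightarrow> Cod C f = y \<Longrightarrow> \<one> y \<cdot> f = f"
  using ident_left homI by blast

lemma assoc:
  "f \<in> Arr C \<Longrightarrow> g \<in> Arr C \<Longrightarrow> h \<in> Arr C \<Longrightarrow> Cod C f = Dom C g \<Longrightarrow> Cod C g = Dom C h \<Longrightarrow>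
    (h \<cdot> g) \<cdot> f = h \<cdot> (g \<cdot> f)"
  by (rule comp_assoc) (auto simp: hom_def)

text \<open>Rewriting is done modulo right-nested composites; these turn an equation between
  composites into a rule that also applies in front of a further factor.\<close>

lemma comp_eq_extend:
  assumes "g \<cdot> f = k"
    and "f \<in> Arr C" "g \<in> Arr C" "h \<in> Arr C" "Cod C h = Dom C f" "Cod C f = Dom C g"
  shows "g \<cdot> (f \<cdot> h) = k \<cdot> h"
  using assms by (simp add: assoc [symmetric])

lemma isoD:
  assumes "iso C u"
  obtains v where "u \<in> Arr C" "v \<in> Arr C" "Dom C v = Cod C u" "Cod C v = Dom C u"
    "v \<cdot> u = \<one> (Dom C u)" "u \<cdot> v = \<one> (Cod C u)"
  using assms by (auto simp: iso_def hom_def)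

lemma isoI:
  assumes "u \<in> Arr C" "v \<in> Arr C" "Dom C v = Cod C u" "Cod C v = Dom C u"
    "v \<cdot> u = \<one> (Dom C u)" "u \<cdot> v = \<one> (Cod C u)"
  shows "iso C u"
  using assms by (auto simp: iso_def hom_def)

lemma iso_ident [simp]: "x \<in> Obj C \<Longrightarrow> iso C (\<one> x)"
  by (rule isoI [of _ "\<one> x"]) simp_all

lemma iso_comp [simp]:
  assumes "iso C f" "iso C g" "Cod C f = Dom C g"
  shows "iso C (g \<cdot> f)"
proof -
  obtain f' where f: "f \<in> Arr C" "f' \<in> Arr C" "Dom C f' = Cod C f" "Cod C f' = Dom C f"
    "f' \<cdot> f = \<one> (Dom C f)" "f \<cdot> f' = \<one> (Cod C f)" using isoD [OF assms(1)] by metis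
  obtain g' where g: "g \<in> Arr C" "g' \<in> Arr C" "Dom C g' = Cod C g" "Cod C g' = Dom C g"
    "g' \<cdot> g = \<one> (Dom C g)" "g \<cdot> g' = \<one> (Cod C g)" using isoD [OF assms(2)] by metis
  \<comment> \<open>These are the inner cancellations left after bracketing the composites of
    \<open>g \<cdot> f\<close> and \<open>f' \<cdot> g'\<close> to the right.\<close>
  have "g' \<cdot> (g \<cdot> f) = f" "f \<cdot> (f' \<cdot> g') = g'"
    using f g assms(3) by (simp_all add: assoc [symmetric])
  then show ?thesis
    by (intro isoI [of _ "f' \<cdot> g'"]) (use f g assms(3) in \<open>simp_all add: assoc\<close>)
qed

lemma iso_cancel_right:
  assumes "f \<cdot> u = g \<cdot> u" "iso C u"
    and "f \<in> Arr C" "g \<in> Arr C" "Dom C f = Cod C u" "Dom C g = Cod C u"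
  shows "f = g"
proof -
  obtain v where v: "u \<in> Arr C" "v \<in> Arr C" "Dom C v = Cod C u" "Cod C v = Dom C u"
    "u \<cdot> v = \<one> (Cod C u)"
    using isoD [OF assms(2)] by metis
  have "(f \<cdot> u) \<cdot> v = (g \<cdot> u) \<cdot> v" using assms(1) by simp
  then show ?thesis using v assms(3-) by (simp add: assoc)
qed

lemma iso_cancel_left:
  assumes "u \<cdot> f = u \<cdot> g" "iso C u"
    and "f \<in> Arr C" "g \<in> Arr C" "Cod C f = Dom C u" "Cod C g = Dom C u"
  shows "f = g"
proof -
  obtain v where v: "u \<in> Arr C" "v \<in> Arr C" "Dom C v = Cod C u" "Cod C v = Dom C u"
    "v \<cdot> u = \<one> (Dom C u)"
    using isoD [OF assms(2)] by metis
  have "v \<cdot> (u \<cdot> f) = v \<cdot> (u \<cdot> g)" using assms(1) by simp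
  then show ?thesis using v assms(3-) by (simp add: assoc [symmetric])
qed

end

section \<open>Typing, functoriality and naturality of the structure maps\<close>

context symmetric_monoidal_category
begin

lemma box_obj_closed [simp]: "x \<in> Obj C \<Longrightarrow> y \<in> Obj C \<Longrightarrow> x \<box> y \<in> Obj C"
  using cat_functor.omap_obj [OF bifunctor, of "(x, y)"] by (simp add: prod_cat_def)

declare unit_obj [simp]

lemma box_arr_simps [simp]:
  assumes "f \<in> Arr C" "g \<in> Arr C"
  shows "f \<box>\<^sub>m g \<in> Arr C" "Dom C (f \<box>\<^sub>m g) = Dom C f \<box> Dom C g"
    "Cod C (f \<box>\<^sub>m g) = Cod C f \<box> Cod C g"
  using cat_functor.amap_hom [OF bifunctor, of "(f, g)" "(Dom C f, Dom C g)" "(Cod C f, Cod C g)"]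
    assms by (simp_all add: prod_cat_def hom_def)

lemma box_ident [simp]: "x \<in> Obj C \<Longrightarrow> y \<in> Obj C \<Longrightarrow> \<one> x \<box>\<^sub>m \<one> y = \<one> (x \<box> y)"
  using cat_functor.amap_ident [OF bifunctor, of "(x, y)"] by (simp add: prod_cat_def)

lemma interchange:
  assumes "f \<in> Arr C" "f' \<in> Arr C" "g \<in> Arr C" "g' \<in> Arr C"
    "Cod C f = Dom C f'" "Cod C g = Dom C g'"
  shows "(f' \<box>\<^sub>m g') \<cdot> (f \<box>\<^sub>m g) = (f' \<cdot> f) \<box>\<^sub>m (g' \<cdot> g)"
  using cat_functor.amap_comp [OF bifunctor, of "(f, g)" "(Dom C f, Dom C g)"
      "(Dom C f', Dom C g')" "(f', g')" "(Cod C f', Cod C g')"] assms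
  by (simp add: prod_cat_def hom_def)

lemma iso_box [simp]:
  assumes "iso C f" "iso C g"
  shows "iso C (f \<box>\<^sub>m g)"
proof -
  obtain f' where f: "f \<in> Arr C" "f' \<in> Arr C" "Dom C f' = Cod C f" "Cod C f' = Dom C f"
    "f' \<cdot> f = \<one> (Dom C f)" "f \<cdot> f' = \<one> (Cod C f)" using isoD [OF assms(1)] by metis
  obtain g' where g: "g \<in> Arr C" "g' \<in> Arr C" "Dom C g' = Cod C g" "Cod C g' = Dom C g"
    "g' \<cdot> g = \<one> (Dom C g)" "g \<cdot> g' = \<one> (Cod C g)" using isoD [OF assms(2)] by metis
  show ?thesis
    by (rule isoI [of _ "f' \<box>\<^sub>m g'"]) (simp_all add: f g interchange)
qed

text \<open>The source \<open>A\<close> stays arbitrary because the structure maps are natural over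
  \<open>C\<close>, its square or its cube.\<close>

lemma nat_transD:
  assumes "natural_isomorphism A C F G \<eta>"
  shows "x \<in> Obj A \<Longrightarrow> \<eta> x \<in> hom C (omap F x) (omap G x)"
    and "f \<in> hom A x y \<Longrightarrow> amap G f \<cdot> \<eta> x = \<eta> y \<cdot> amap F f"
    and "x \<in> Obj A \<Longrightarrow> iso C (\<eta> x)"
proof -
  interpret natural_isomorphism A C F G \<eta> by (fact assms)
  show "x \<in> Obj A \<Longrightarrow> \<eta> x \<in> hom C (omap F x) (omap G x)" by (rule component_hom)
  show "f \<in> hom A x y \<Longrightarrow> amap G f \<cdot> \<eta> x = \<eta> y \<cdot> amap F f" by (rule naturality)
  show "x \<in> Obj A \<Longrightarrow> iso C (\<eta> x)" by (rule component_iso)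
qed

lemma alpha_simps [simp]:
  assumes "x \<in> Obj C" "y \<in> Obj C" "z \<in> Obj C"
  shows "\<alpha> x y z \<in> Arr C" "Dom C (\<alpha> x y z) = (x \<box> y) \<box> z" "Cod C (\<alpha> x y z) = x \<box> y \<box> z"
    "iso C (\<alpha> x y z)"
  using nat_transD(1,3) [OF associator, of "(x, y, z)"] assms
  by (simp_all add: prod_cat_def hom_def)

lemma lam_simps [simp]:
  assumes "x \<in> Obj C"
  shows "lam x \<in> Arr C" "Dom C (lam x) = e \<box> x" "Cod C (lam x) = x" "iso C (lam x)"
  using nat_transD(1,3) [OF left_unitor, of x] assms by (simp_all add: hom_def)

lemma rho_simps [simp]:
  assumes "x \<in> Obj C"
  shows "\<rho> x \<in> Arr C" "Dom C (\<rho> x) = x \<box> e" "Cod C (\<rho> x) = x" "iso C (\<rho> x)"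
  using nat_transD(1,3) [OF right_unitor, of x] assms by (simp_all add: hom_def)

lemma tau_simps [simp]:
  assumes "x \<in> Obj C" "y \<in> Obj C"
  shows "\<tau> x y \<in> Arr C" "Dom C (\<tau> x y) = x \<box> y" "Cod C (\<tau> x y) = y \<box> x" "iso C (\<tau> x y)"
  using nat_transD(1,3) [OF braiding, of "(x, y)"] assms
  by (simp_all add: prod_cat_def hom_def)

lemma gamma_simps [simp]:
  assumes "x \<in> Obj C" "y \<in> Obj C" "z \<in> Obj C"
  shows "\<gamma> x y z \<in> Arr C" "Dom C (\<gamma> x y z) = x \<box> y \<box> z" "Cod C (\<gamma> x y z) = y \<box> x \<box> z"
    "iso C (\<gamma> x y z)"
  using nat_transD(1,3) [OF parallel_associator, of "(x, y, z)"] assms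
  by (simp_all add: prod_cat_def hom_def)

text \<open>The codomains are variables tied by equations, so the rule applies however the indices
  of \<alpha> are written; the domains on the right are left for the simplifier to compute.\<close>

lemma alpha_natural:
  assumes "f \<in> Arr C" "g \<in> Arr C" "h \<in> Arr C"
    "Cod C f = x'" "Cod C g = y'" "Cod C h = z'"
  shows "\<alpha> x' y' z' \<cdot> ((f \<box>\<^sub>m g) \<box>\<^sub>m h) = (f \<box>\<^sub>m (g \<box>\<^sub>m h)) \<cdot> \<alpha> (Dom C f) (Dom C g) (Dom C h)"
  using nat_transD(2) [OF associator, of "(f, g, h)" "(Dom C f, Dom C g, Dom C h)" "(x', y', z')"]
    assms
  by (simp add: prod_cat_def hom_def)

text \<open>Instances with two identities are recorded in the form left by \<open>box_ident\<close>,
  with neighbouring identities merged. In \<open>alpha_natural_right\<close> the merged factor would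
  no longer match the general rule.\<close>

lemma alpha_natural_left:
  "f \<in> Arr C \<Longrightarrow> y \<in> Obj C \<Longrightarrow> z \<in> Obj C \<Longrightarrow> Cod C f = x' \<Longrightarrow>
    \<alpha> x' y z \<cdot> ((f \<box>\<^sub>m \<one> y) \<box>\<^sub>m \<one> z) = (f \<box>\<^sub>m \<one> (y \<box> z)) \<cdot> \<alpha> (Dom C f) y z"
  using alpha_natural [of f "\<one> y" "\<one> z", OF _ _ _ _ refl refl] by simp

lemma alpha_natural_mid:
  "f \<in> Arr C \<Longrightarrow> x \<in> Obj C \<Longrightarrow> z \<in> Obj C \<Longrightarrow> Cod C f = y' \<Longrightarrow>
    \<alpha> x y' z \<cdot> ((\<one> x \<box>\<^sub>m f) \<box>\<^sub>m \<one> z) = (\<one> x \<box>\<^sub>m (f \<box>\<^sub>m \<one> z)) \<cdot> \<alpha> x (Dom C f) z"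
  using alpha_natural [of "\<one> x" f "\<one> z", OF _ _ _ refl _ refl] by simp

lemma alpha_natural_right:
  "f \<in> Arr C \<Longrightarrow> x \<in> Obj C \<Longrightarrow> y \<in> Obj C \<Longrightarrow> Cod C f = z' \<Longrightarrow>
    \<alpha> x y z' \<cdot> (\<one> (x \<box> y) \<box>\<^sub>m f) = (\<one> x \<box>\<^sub>m (\<one> y \<box>\<^sub>m f)) \<cdot> \<alpha> x y (Dom C f)"
  using alpha_natural [of "\<one> x" "\<one> y" f, OF _ _ _ refl refl] by simp

lemma lam_natural:
  "f \<in> Arr C \<Longrightarrow> Cod C f = y \<Longrightarrow> lam y \<cdot> (\<one> e \<box>\<^sub>m f) = f \<cdot> lam (Dom C f)"
  using nat_transD(2) [OF left_unitor, of f "Dom C f" y] by (simp add: hom_def)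

lemma rho_natural:
  "f \<in> Arr C \<Longrightarrow> Cod C f = y \<Longrightarrow> \<rho> y \<cdot> (f \<box>\<^sub>m \<one> e) = f \<cdot> \<rho> (Dom C f)"
  using nat_transD(2) [OF right_unitor, of f "Dom C f" y] by (simp add: hom_def)

lemma tau_natural:
  assumes "f \<in> Arr C" "g \<in> Arr C" "Cod C f = x'" "Cod C g = y'"
  shows "\<tau> x' y' \<cdot> (f \<box>\<^sub>m g) = (g \<box>\<^sub>m f) \<cdot> \<tau> (Dom C f) (Dom C g)"
  using nat_transD(2) [OF braiding, of "(f, g)" "(Dom C f, Dom C g)" "(x', y')"] assms
  by (simp add: prod_cat_def hom_def)

lemma gamma_natural:
  assumes "f \<in> Arr C" "g \<in> Arr C" "h \<in> Arr C"
    "Cod C f = x'" "Cod C g = y'" "Cod C h = z'"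
  shows "\<gamma> x' y' z' \<cdot> (f \<box>\<^sub>m (g \<box>\<^sub>m h)) = (g \<box>\<^sub>m (f \<box>\<^sub>m h)) \<cdot> \<gamma> (Dom C f) (Dom C g) (Dom C h)"
  using nat_transD(2) [OF parallel_associator, of "(f, g, h)" "(Dom C f, Dom C g, Dom C h)"
      "(x', y', z')"] assms
  by (simp add: prod_cat_def hom_def)

lemma gamma_natural_mid:
  "f \<in> Arr C \<Longrightarrow> x \<in> Obj C \<Longrightarrow> z \<in> Obj C \<Longrightarrow> Cod C f = y' \<Longrightarrow>
    \<gamma> x y' z \<cdot> (\<one> x \<box>\<^sub>m (f \<box>\<^sub>m \<one> z)) = (f \<box>\<^sub>m \<one> (x \<box> z)) \<cdot> \<gamma> x (Dom C f) z"
  using gamma_natural [of "\<one> x" f "\<one> z", OF _ _ _ refl _ refl] by simp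

section \<open>Kelly's unit identities\<close>

lemma unit_box_faithful:
  assumes eq: "\<one> e \<box>\<^sub>m f = \<one> e \<box>\<^sub>m g" and f: "f \<in> hom C x y" and g: "g \<in> hom C x y"
  shows "f = g"
proof -
  note [simp] = homD [OF f] homD [OF g]
  have [simp]: "x \<in> Obj C" "y \<in> Obj C" using dom_obj [of f] cod_obj [of f] by simp_all
  \<comment> \<open>Naturality of \<open>lam\<close> recovers an arrow from its image under
    tensoring with the unit, up to isomorphisms.\<close>
  have "f \<cdot> lam x = g \<cdot> lam x"
    using lam_natural [of f y] lam_natural [of g y] eq by simp
  then show ?thesis by (rule iso_cancel_right) simp_all
qed

lemma box_unit_faithful:
  assumes eq: "f \<box>\<^sub>m \<one> e = g \<box>\<^sub>m \<one> e" and f: "f \<in> hom C x y" and g: "g \<in> hom C x y"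
  shows "f = g"
proof -
  note [simp] = homD [OF f] homD [OF g]
  have [simp]: "x \<in> Obj C" "y \<in> Obj C" using dom_obj [of f] cod_obj [of f] by simp_all
  have "f \<cdot> \<rho> x = g \<cdot> \<rho> x"
    using rho_natural [of f y] rho_natural [of g y] eq by simp
  then show ?thesis by (rule iso_cancel_right) simp_all
qed

text \<open>Opposite orientation to \<open>interchange\<close>: splitting a whiskered composite
  exposes single structure maps to rewriting.\<close>

lemma box_comp_left:
  "f \<in> Arr C \<Longrightarrow> g \<in> Arr C \<Longrightarrow> x \<in> Obj C \<Longrightarrow> Cod C f = Dom C g \<Longrightarrow>
    (g \<cdot> f) \<box>\<^sub>m \<one> x = (g \<box>\<^sub>m \<one> x) \<cdot> (f \<box>\<^sub>m \<one> x)"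
  by (simp add: interchange)

lemma box_comp_right:
  "f \<in> Arr C \<Longrightarrow> g \<in> Arr C \<Longrightarrow> x \<in> Obj C \<Longrightarrow> Cod C f = Dom C g \<Longrightarrow>
    \<one> x \<box>\<^sub>m (g \<cdot> f) = (\<one> x \<box>\<^sub>m g) \<cdot> (\<one> x \<box>\<^sub>m f)"
  by (simp add: interchange)

lemma pentagon:
  assumes [simp]: "x \<in> Obj C" "y \<in> Obj C" "z \<in> Obj C" "t \<in> Obj C"
  shows "(\<one> x \<box>\<^sub>m \<alpha> y z t) \<cdot> (\<alpha> x (y \<box> z) t \<cdot> (\<alpha> x y z \<box>\<^sub>m \<one> t))
    = \<alpha> x y (z \<box> t) \<cdot> \<alpha> (x \<box> y) z t"
  using C1 [of x y z t] by (simp add: assoc)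

text \<open>Tensored with \<open>e\<close> on the left and precomposed with two edges of the
  pentagon at \<open>e, e, x, y\<close>, both sides reduce by the triangle to
  \<open>\<rho> e\<close>, tensored with \<open>x\<close> and \<open>y\<close>; naturality of
  \<alpha> matches the bracketings.\<close>

lemma lam_alpha:
  assumes [simp]: "x \<in> Obj C" "y \<in> Obj C"
  shows "lam (x \<box> y) \<cdot> \<alpha> e x y = lam x \<box>\<^sub>m \<one> y"
proof (rule unit_box_faithful)
  have "(\<one> e \<box>\<^sub>m (lam (x \<box> y) \<cdot> \<alpha> e x y)) \<cdot> (\<alpha> e (e \<box> x) y \<cdot> (\<alpha> e e x \<box>\<^sub>m \<one> y))
      = (\<one> e \<box>\<^sub>m lam (x \<box> y)) \<cdot> (\<alpha> e e (x \<box> y) \<cdot> \<alpha> (e \<box> e) x y)"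
    by (simp add: box_comp_right assoc pentagon)
  also have "\<dots> = (\<rho> e \<box>\<^sub>m \<one> (x \<box> y)) \<cdot> \<alpha> (e \<box> e) x y"
    by (simp add: comp_eq_extend [OF C2])
  also have "\<dots> = \<alpha> e x y \<cdot> ((\<rho> e \<box>\<^sub>m \<one> x) \<box>\<^sub>m \<one> y)"
    by (simp add: alpha_natural_left)
  \<comment> \<open>The triangle is read backwards here, which restores the edge
    \<open>\<alpha> e e x \<box>\<^sub>m \<one> y\<close> to be cancelled at the end.\<close>
  also have "\<dots> = \<alpha> e x y \<cdot> (((\<one> e \<box>\<^sub>m lam x) \<box>\<^sub>m \<one> y) \<cdot> (\<alpha> e e x \<box>\<^sub>m \<one> y))"
    by (simp add: box_comp_left [symmetric] C2)
  also have "\<dots> = (\<one> e \<box>\<^sub>m (lam x \<box>\<^sub>m \<one> y)) \<cdot> (\<alpha> e (e \<box> x) y \<cdot> (\<alpha> e e x \<box>\<^sub>m \<one> y))"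
    by (simp add: comp_eq_extend [OF alpha_natural_mid] assoc)
  finally show "\<one> e \<box>\<^sub>m (lam (x \<box> y) \<cdot> \<alpha> e x y) = \<one> e \<box>\<^sub>m (lam x \<box>\<^sub>m \<one> y)"
    by (rule iso_cancel_right) simp_all
qed (auto simp: hom_def)

text \<open>Mirror image of \<open>lam_alpha\<close>: the pentagon at \<open>x, y, e, e\<close>
  links the triangle for \<open>y, e\<close> to the one for \<open>x \<box> y, e\<close>.\<close>

lemma rho_alpha:
  assumes [simp]: "x \<in> Obj C" "y \<in> Obj C"
  shows "(\<one> x \<box>\<^sub>m \<rho> y) \<cdot> \<alpha> x y e = \<rho> (x \<box> y)"
proof (rule box_unit_faithful)
  have "\<alpha> x y e \<cdot> (((\<one> x \<box>\<^sub>m \<rho> y) \<cdot> \<alpha> x y e) \<box>\<^sub>m \<one> e)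
      = (\<one> x \<box>\<^sub>m (\<rho> y \<box>\<^sub>m \<one> e)) \<cdot> (\<alpha> x (y \<box> e) e \<cdot> (\<alpha> x y e \<box>\<^sub>m \<one> e))"
    by (simp add: box_comp_left comp_eq_extend [OF alpha_natural_mid] assoc)
  also have "\<dots> = (\<one> x \<box>\<^sub>m (\<one> y \<box>\<^sub>m lam e)) \<cdot>
      ((\<one> x \<box>\<^sub>m \<alpha> y e e) \<cdot> (\<alpha> x (y \<box> e) e \<cdot> (\<alpha> x y e \<box>\<^sub>m \<one> e)))"
    by (simp add: C2 [of y e, symmetric] box_comp_right assoc)
  also have "\<dots> = ((\<one> x \<box>\<^sub>m (\<one> y \<box>\<^sub>m lam e)) \<cdot> \<alpha> x y (e \<box> e)) \<cdot> \<alpha> (x \<box> y) e e"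
    by (simp add: pentagon assoc)
  also have "\<dots> = \<alpha> x y e \<cdot> ((\<one> (x \<box> y) \<box>\<^sub>m lam e) \<cdot> \<alpha> (x \<box> y) e e)"
    by (simp add: comp_eq_extend [OF alpha_natural_right] assoc)
  also have "\<dots> = \<alpha> x y e \<cdot> (\<rho> (x \<box> y) \<box>\<^sub>m \<one> e)"
    by (simp add: C2)
  finally show "((\<one> x \<box>\<^sub>m \<rho> y) \<cdot> \<alpha> x y e) \<box>\<^sub>m \<one> e = \<rho> (x \<box> y) \<box>\<^sub>m \<one> e"
    by (rule iso_cancel_left) simp_all
qed (auto simp: hom_def)

lemma lam_unit: "lam e = \<rho> e"
proof (rule box_unit_faithful)
  \<comment> \<open>Naturality of \<open>lam\<close> at the arrow \<open>lam e\<close> itself;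
    cancelling \<open>lam e\<close> makes \<open>lam_alpha\<close> and the triangle at
    \<open>e, e\<close> comparable.\<close>
  have "lam e \<cdot> lam (e \<box> e) = lam e \<cdot> (\<one> e \<box>\<^sub>m lam e)"
    by (simp add: lam_natural)
  then have "lam (e \<box> e) = \<one> e \<box>\<^sub>m lam e"
    by (rule iso_cancel_left) simp_all
  then show "lam e \<box>\<^sub>m \<one> e = \<rho> e \<box>\<^sub>m \<one> e"
    using lam_alpha [of e e] C2 [of e e] by simp
qed (auto simp: hom_def)

section \<open>Unit identities for \<tau> and \<gamma>, and involutivity of \<gamma>\<close>

lemma lam_gamma:
  assumes [simp]: "x \<in> Obj C" "y \<in> Obj C"
  shows "lam (x \<box> y) \<cdot> \<gamma> x e y = \<one> x \<box>\<^sub>m lam y"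
proof -
  \<comment> \<open>Naturality of \<open>lam\<close> moves the added \<open>\<tau> x y\<close>
    inside, where it forms the left side of \<open>C5\<close> at \<open>x, e, y\<close>.\<close>
  have "\<tau> x y \<cdot> (lam (x \<box> y) \<cdot> \<gamma> x e y) = lam (y \<box> x) \<cdot> ((\<one> e \<box>\<^sub>m \<tau> x y) \<cdot> \<gamma> x e y)"
    by (simp add: comp_eq_extend [OF lam_natural] assoc)
  also have "\<dots> = (lam y \<box>\<^sub>m \<one> x) \<cdot> \<tau> x (e \<box> y)"
    by (simp add: C5 comp_eq_extend [OF lam_alpha])
  also have "\<dots> = \<tau> x y \<cdot> (\<one> x \<box>\<^sub>m lam y)"
    by (simp add: tau_natural)
  finally show ?thesis
    by (rule iso_cancel_left) simp_all
qed

text \<open>After tensoring with \<open>e\<close> on the right, \<open>lam_alpha\<close> and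
  \<open>C4\<close> trade the braiding for \<gamma>, which \<open>lam_gamma\<close> absorbs; the
  triangle remains.\<close>

lemma lam_tau:
  assumes [simp]: "x \<in> Obj C"
  shows "lam x \<cdot> \<tau> x e = \<rho> x"
proof (rule box_unit_faithful)
  have "(lam x \<cdot> \<tau> x e) \<box>\<^sub>m \<one> e = lam (x \<box> e) \<cdot> (\<alpha> e x e \<cdot> (\<tau> x e \<box>\<^sub>m \<one> e))"
    by (simp add: box_comp_left lam_alpha [symmetric] assoc)
  also have "\<dots> = (lam (x \<box> e) \<cdot> \<gamma> x e e) \<cdot> \<alpha> x e e"
    by (simp add: C4 [symmetric] assoc)
  also have "\<dots> = \<rho> x \<box>\<^sub>m \<one> e"
    by (simp add: lam_gamma C2)
  finally show "(lam x \<cdot> \<tau> x e) \<box>\<^sub>m \<one> e = \<rho> x \<box>\<^sub>m \<one> e" .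
qed (auto simp: hom_def)

lemma rho_tau:
  assumes [simp]: "x \<in> Obj C"
  shows "\<rho> x \<cdot> \<tau> e x = lam x"
  by (simp add: lam_tau [symmetric] assoc C3)

text \<open>As a conjugate of \<open>\<tau> x y \<box>\<^sub>m \<one> z\<close> by \<alpha>,
  \<gamma> inherits the symmetry \<open>C3\<close>.\<close>

lemma gamma_gamma:
  assumes [simp]: "x \<in> Obj C" "y \<in> Obj C" "z \<in> Obj C"
  shows "\<gamma> y x z \<cdot> \<gamma> x y z = \<one> (x \<box> y \<box> z)"
proof -
  have "(\<gamma> y x z \<cdot> \<gamma> x y z) \<cdot> \<alpha> x y z = \<gamma> y x z \<cdot> (\<alpha> y x z \<cdot> (\<tau> x y \<box>\<^sub>m \<one> z))"
    by (simp add: assoc C4)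
  also have "\<dots> = \<alpha> x y z \<cdot> ((\<tau> y x \<box>\<^sub>m \<one> z) \<cdot> (\<tau> x y \<box>\<^sub>m \<one> z))"
    by (simp add: comp_eq_extend [OF C4] assoc)
  also have "\<dots> = \<one> (x \<box> y \<box> z) \<cdot> \<alpha> x y z"
    by (simp add: interchange C3)
  finally show ?thesis
    by (rule iso_cancel_right) simp_all
qed

text \<open>Whiskered involutions are kept separately so that \<open>comp_eq_extend\<close> can
  cancel such pairs inside longer composites.\<close>

lemma one_gamma_gamma:
  assumes [simp]: "x \<in> Obj C" "y \<in> Obj C" "z \<in> Obj C" "w \<in> Obj C"
  shows "(\<one> w \<box>\<^sub>m \<gamma> y x z) \<cdot> (\<one> w \<box>\<^sub>m \<gamma> x y z) = \<one> (w \<box> x \<box> y \<box> z)"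
  by (simp add: interchange gamma_gamma)

lemma one_tau_tau:
  assumes [simp]: "x \<in> Obj C" "y \<in> Obj C" "w \<in> Obj C"
  shows "(\<one> w \<box>\<^sub>m \<tau> y x) \<cdot> (\<one> w \<box>\<^sub>m \<tau> x y) = \<one> (w \<box> x \<box> y)"
  by (simp add: interchange C3)

lemma lam_gamma_unit:
  assumes [simp]: "x \<in> Obj C" "y \<in> Obj C"
  shows "(\<one> x \<box>\<^sub>m lam y) \<cdot> \<gamma> e x y = lam (x \<box> y)"
  by (simp add: lam_gamma [symmetric] assoc gamma_gamma)

text \<open>Precomposing with \<open>\<alpha> x y e\<close> turns this, by \<open>C4\<close> and
  \<open>rho_alpha\<close>, into naturality of \<rho> at \<open>\<tau> x y\<close>.\<close>

lemma rho_gamma: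
  assumes [simp]: "x \<in> Obj C" "y \<in> Obj C"
  shows "(\<one> y \<box>\<^sub>m \<rho> x) \<cdot> \<gamma> x y e = \<tau> x y \<cdot> (\<one> x \<box>\<^sub>m \<rho> y)"
proof -
  have "((\<one> y \<box>\<^sub>m \<rho> x) \<cdot> \<gamma> x y e) \<cdot> \<alpha> x y e = \<rho> (y \<box> x) \<cdot> (\<tau> x y \<box>\<^sub>m \<one> e)"
    by (simp add: assoc C4 comp_eq_extend [OF rho_alpha])
  also have "\<dots> = (\<tau> x y \<cdot> (\<one> x \<box>\<^sub>m \<rho> y)) \<cdot> \<alpha> x y e"
    by (simp add: assoc rho_natural rho_alpha)
  finally show ?thesis
    by (rule iso_cancel_right) simp_all
qed

section \<open>Compatibility of \<gamma> with \<tau> and \<alpha>\<close>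

lemma gamma_tau:
  assumes [simp]: "x \<in> Obj C" "y \<in> Obj C" "z \<in> Obj C"
  shows "\<gamma> y x z \<cdot> \<tau> (x \<box> z) y = (\<one> x \<box>\<^sub>m \<tau> z y) \<cdot> \<alpha> x z y"
proof -
  \<comment> \<open>The added factor completes the left side of \<open>C5\<close> at
    \<open>y, x, z\<close>; the two braidings of \<open>y\<close> with \<open>x \<box> z\<close>
    then cancel.\<close>
  have "(\<one> x \<box>\<^sub>m \<tau> y z) \<cdot> (\<gamma> y x z \<cdot> \<tau> (x \<box> z) y) = \<alpha> x z y"
    by (simp add: comp_eq_extend [OF C5] assoc C3)
  also have "\<dots> = (\<one> x \<box>\<^sub>m \<tau> y z) \<cdot> ((\<one> x \<box>\<^sub>m \<tau> z y) \<cdot> \<alpha> x z y)"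
    by (simp add: comp_eq_extend [OF one_tau_tau])
  finally show ?thesis
    by (rule iso_cancel_left) simp_all
qed

text \<open>The pentagons at \<open>y, x, z, t\<close> and at \<open>x, y, z, t\<close> are joined
  by \<open>\<tau> x y\<close>, which naturality carries through \<alpha>; \<open>C4\<close>
  converts between \<tau> and \<gamma> at both ends.\<close>

lemma alpha_gamma:
  assumes [simp]: "x \<in> Obj C" "y \<in> Obj C" "z \<in> Obj C" "t \<in> Obj C"
  shows "(\<one> y \<box>\<^sub>m \<alpha> x z t) \<cdot> (\<alpha> y (x \<box> z) t \<cdot> (\<gamma> x y z \<box>\<^sub>m \<one> t))
    = \<gamma> x y (z \<box> t) \<cdot> ((\<one> x \<box>\<^sub>m \<alpha> y z t) \<cdot> \<alpha> x (y \<box> z) t)"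
proof -
  have "((\<one> y \<box>\<^sub>m \<alpha> x z t) \<cdot> (\<alpha> y (x \<box> z) t \<cdot> (\<gamma> x y z \<box>\<^sub>m \<one> t))) \<cdot> (\<alpha> x y z \<box>\<^sub>m \<one> t)
      = (\<one> y \<box>\<^sub>m \<alpha> x z t) \<cdot> (\<alpha> y (x \<box> z) t \<cdot> ((\<gamma> x y z \<cdot> \<alpha> x y z) \<box>\<^sub>m \<one> t))"
    by (simp add: assoc interchange)
  also have "\<dots> = ((\<one> y \<box>\<^sub>m \<alpha> x z t) \<cdot> (\<alpha> y (x \<box> z) t \<cdot> (\<alpha> y x z \<box>\<^sub>m \<one> t)))
      \<cdot> ((\<tau> x y \<box>\<^sub>m \<one> z) \<box>\<^sub>m \<one> t)"
    by (simp add: C4 box_comp_left assoc)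
  also have "\<dots> = \<alpha> y x (z \<box> t) \<cdot> ((\<tau> x y \<box>\<^sub>m \<one> (z \<box> t)) \<cdot> \<alpha> (x \<box> y) z t)"
    by (simp add: pentagon assoc alpha_natural_left)
  also have "\<dots> = \<gamma> x y (z \<box> t) \<cdot> (\<alpha> x y (z \<box> t) \<cdot> \<alpha> (x \<box> y) z t)"
    by (simp add: comp_eq_extend [OF C4] assoc)
  also have "\<dots> = (\<gamma> x y (z \<box> t) \<cdot> ((\<one> x \<box>\<^sub>m \<alpha> y z t) \<cdot> \<alpha> x (y \<box> z) t)) \<cdot> (\<alpha> x y z \<box>\<^sub>m \<one> t)"
    by (simp add: pentagon assoc)
  finally show ?thesis
    by (rule iso_cancel_right) simp_all
qed

lemma gamma_tau_alpha:
  assumes [simp]: "x \<in> Obj C" "y \<in> Obj C" "z \<in> Obj C"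
  shows "\<gamma> y x z \<cdot> ((\<one> y \<box>\<^sub>m \<tau> z x) \<cdot> \<alpha> y z x) = \<tau> (y \<box> z) x"
proof -
  \<comment> \<open>With \<open>\<tau> x (y \<box> z)\<close> in front, \<open>C5\<close> produces
    adjacent inverse pairs, so both sides become the identity.\<close>
  have "(\<gamma> y x z \<cdot> ((\<one> y \<box>\<^sub>m \<tau> z x) \<cdot> \<alpha> y z x)) \<cdot> \<tau> x (y \<box> z)
      = \<gamma> y x z \<cdot> ((\<one> y \<box>\<^sub>m \<tau> z x) \<cdot> ((\<one> y \<box>\<^sub>m \<tau> x z) \<cdot> \<gamma> x y z))"
    by (simp add: assoc C5)
  also have "\<dots> = \<tau> (y \<box> z) x \<cdot> \<tau> x (y \<box> z)"
    by (simp add: comp_eq_extend [OF one_tau_tau] gamma_gamma C3)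
  finally show ?thesis
    by (rule iso_cancel_right) simp_all
qed

lemma gamma_gamma_alpha:
  assumes [simp]: "x \<in> Obj C" "y \<in> Obj C" "z \<in> Obj C" "t \<in> Obj C"
  shows "\<gamma> y x (z \<box> t) \<cdot> ((\<one> y \<box>\<^sub>m \<gamma> z x t) \<cdot> \<alpha> y z (x \<box> t))
    = (\<one> x \<box>\<^sub>m \<alpha> y z t) \<cdot> \<gamma> (y \<box> z) x t"
proof -
  have "((\<one> x \<box>\<^sub>m \<alpha> y z t) \<cdot> \<gamma> (y \<box> z) x t) \<cdot> \<alpha> (y \<box> z) x t
      = (\<one> x \<box>\<^sub>m \<alpha> y z t) \<cdot> (\<alpha> x (y \<box> z) t \<cdot> (\<tau> (y \<box> z) x \<box>\<^sub>m \<one> t))"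
    by (simp add: assoc C4)
  \<comment> \<open>Expanding the braiding by \<open>gamma_tau_alpha\<close> creates the left side
    of \<open>alpha_gamma\<close> at \<open>y, x, z, t\<close>.\<close>
  also have "\<dots> = ((\<one> x \<box>\<^sub>m \<alpha> y z t) \<cdot> (\<alpha> x (y \<box> z) t \<cdot> (\<gamma> y x z \<box>\<^sub>m \<one> t)))
      \<cdot> (((\<one> y \<box>\<^sub>m \<tau> z x) \<box>\<^sub>m \<one> t) \<cdot> (\<alpha> y z x \<box>\<^sub>m \<one> t))"
    by (simp add: gamma_tau_alpha [symmetric] box_comp_left assoc)
  also have "\<dots> = \<gamma> y x (z \<box> t) \<cdot> ((\<one> y \<box>\<^sub>m \<alpha> x z t) \<cdot>
      ((\<one> y \<box>\<^sub>m (\<tau> z x \<box>\<^sub>m \<one> t)) \<cdot> (\<alpha> y (z \<box> x) t \<cdot> (\<alpha> y z x \<box>\<^sub>m \<one> t))))"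
    by (simp add: alpha_gamma assoc comp_eq_extend [OF alpha_natural_mid])
  \<comment> \<open>\<open>C4\<close> is used backwards under \<open>y \<box> -\<close>; the three
    associators this leaves form the long side of the pentagon at \<open>y, z, x, t\<close>.\<close>
  also have "\<dots> = \<gamma> y x (z \<box> t) \<cdot> ((\<one> y \<box>\<^sub>m (\<gamma> z x t \<cdot> \<alpha> z x t)) \<cdot>
      (\<alpha> y (z \<box> x) t \<cdot> (\<alpha> y z x \<box>\<^sub>m \<one> t)))"
    by (simp add: C4 box_comp_right assoc)
  also have "\<dots> = (\<gamma> y x (z \<box> t) \<cdot> ((\<one> y \<box>\<^sub>m \<gamma> z x t) \<cdot> \<alpha> y z (x \<box> t))) \<cdot> \<alpha> (y \<box> z) x t"
    by (simp add: box_comp_right assoc pentagon)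
  finally show ?thesis
    by (rule iso_cancel_right [OF sym]) simp_all
qed

lemma gamma_alpha_gamma:
  assumes [simp]: "x \<in> Obj C" "y \<in> Obj C" "z \<in> Obj C" "t \<in> Obj C"
  shows "\<gamma> y x (z \<box> t) \<cdot> ((\<one> y \<box>\<^sub>m \<alpha> x z t) \<cdot> \<gamma> (x \<box> z) y t)
    = (\<one> x \<box>\<^sub>m \<gamma> z y t) \<cdot> \<alpha> x z (y \<box> t)"
  by (simp add: gamma_gamma_alpha [symmetric] comp_eq_extend [OF gamma_gamma])

lemma alpha_gamma_box:
  assumes [simp]: "x \<in> Obj C" "y \<in> Obj C" "z \<in> Obj C" "t \<in> Obj C"
  shows "\<alpha> x y (z \<box> t) \<cdot> \<gamma> z (x \<box> y) t
    = (\<one> x \<box>\<^sub>m \<gamma> z y t) \<cdot> (\<gamma> z x (y \<box> t) \<cdot> (\<one> z \<box>\<^sub>m \<alpha> x y t))"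
proof -
  \<comment> \<open>The inserted pair of inverse \<gamma> creates the right side of
    \<open>gamma_gamma_alpha\<close> with \<open>x, y, z\<close> replaced by
    \<open>z, x, y\<close>.\<close>
  have "\<one> z \<box>\<^sub>m \<alpha> x y t = ((\<one> z \<box>\<^sub>m \<alpha> x y t) \<cdot> \<gamma> (x \<box> y) z t) \<cdot> \<gamma> z (x \<box> y) t"
    by (simp add: assoc gamma_gamma)
  also have "\<dots> = \<gamma> x z (y \<box> t) \<cdot> ((\<one> x \<box>\<^sub>m \<gamma> y z t) \<cdot> (\<alpha> x y (z \<box> t) \<cdot> \<gamma> z (x \<box> y) t))"
    by (simp add: gamma_gamma_alpha [symmetric] assoc)
  finally show ?thesis
    by (simp add: comp_eq_extend [OF gamma_gamma] comp_eq_extend [OF one_gamma_gamma])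
qed

section \<open>Yang-Baxter identities\<close>

lemma yang_baxter_tau:
  assumes [simp]: "x \<in> Obj C" "y \<in> Obj C" "z \<in> Obj C"
  shows "\<gamma> y x z \<cdot> ((\<one> y \<box>\<^sub>m \<tau> z x) \<cdot> \<gamma> z y x)
    = (\<one> x \<box>\<^sub>m \<tau> z y) \<cdot> (\<gamma> z x y \<cdot> (\<one> z \<box>\<^sub>m \<tau> y x))"
proof -
  have "\<gamma> y x z \<cdot> ((\<one> y \<box>\<^sub>m \<tau> z x) \<cdot> \<gamma> z y x) = \<alpha> x y z \<cdot> ((\<tau> y x \<box>\<^sub>m \<one> z) \<cdot> \<tau> z (y \<box> x))"
    by (simp add: C5 comp_eq_extend [OF C4] assoc)
  \<comment> \<open>Naturality of \<tau> in its second argument, at \<open>\<tau> y x\<close>,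
    exchanges the order of the braidings.\<close>
  also have "\<dots> = (\<alpha> x y z \<cdot> \<tau> z (x \<box> y)) \<cdot> (\<one> z \<box>\<^sub>m \<tau> y x)"
    by (simp add: assoc tau_natural)
  also have "\<dots> = (\<one> x \<box>\<^sub>m \<tau> z y) \<cdot> (\<gamma> z x y \<cdot> (\<one> z \<box>\<^sub>m \<tau> y x))"
    by (simp add: C5 [symmetric] assoc)
  finally show ?thesis .
qed

lemma yang_baxter_gamma:
  assumes [simp]: "x \<in> Obj C" "y \<in> Obj C" "z \<in> Obj C" "t \<in> Obj C"
  shows "\<gamma> y x (z \<box> t) \<cdot> ((\<one> y \<box>\<^sub>m \<gamma> z x t) \<cdot> \<gamma> z y (x \<box> t))
    = (\<one> x \<box>\<^sub>m \<gamma> z y t) \<cdot> (\<gamma> z x (y \<box> t) \<cdot> (\<one> z \<box>\<^sub>m \<gamma> y x t))"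
proof -
  \<comment> \<open>The factor \<open>\<one> z \<box>\<^sub>m \<alpha> y x t\<close> allows
    \<open>alpha_gamma_box\<close> to merge two \<gamma> into one that moves \<open>z\<close> past
    \<open>y \<box> x\<close>.\<close>
  have "(\<gamma> y x (z \<box> t) \<cdot> ((\<one> y \<box>\<^sub>m \<gamma> z x t) \<cdot> \<gamma> z y (x \<box> t))) \<cdot> (\<one> z \<box>\<^sub>m \<alpha> y x t)
      = \<gamma> y x (z \<box> t) \<cdot> (\<alpha> y x (z \<box> t) \<cdot> \<gamma> z (y \<box> x) t)"
    by (simp add: alpha_gamma_box assoc)
  also have "\<dots> = \<alpha> x y (z \<box> t) \<cdot> ((\<tau> y x \<box>\<^sub>m \<one> (z \<box> t)) \<cdot> \<gamma> z (y \<box> x) t)"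
    by (simp add: comp_eq_extend [OF C4] assoc)
  \<comment> \<open>Naturality of \<gamma> in its middle argument, at \<open>\<tau> y x\<close>, is
    the actual exchange; the remaining steps undo the merging with \<open>x\<close> and
    \<open>y\<close> swapped.\<close>
  also have "\<dots> = (\<alpha> x y (z \<box> t) \<cdot> \<gamma> z (x \<box> y) t) \<cdot> (\<one> z \<box>\<^sub>m (\<tau> y x \<box>\<^sub>m \<one> t))"
    by (simp add: gamma_natural_mid assoc)
  also have "\<dots> = (\<one> x \<box>\<^sub>m \<gamma> z y t) \<cdot> (\<gamma> z x (y \<box> t) \<cdot> (\<one> z \<box>\<^sub>m (\<alpha> x y t \<cdot> (\<tau> y x \<box>\<^sub>m \<one> t))))"
    by (simp add: alpha_gamma_box assoc box_comp_right)
  also have "\<dots> = ((\<one> x \<box>\<^sub>m \<gamma> z y t) \<cdot> (\<gamma> z x (y \<box> t) \<cdot> (\<one> z \<box>\<^sub>m \<gamma> y x t))) \<cdot> (\<one> z \<box>\<^sub>m \<alpha> y x t)"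
    by (simp add: C4 [symmetric] box_comp_right assoc)
  finally show ?thesis
    by (rule iso_cancel_right) simp_all
qed

end

theorem corollary8:
  fixes C :: "('o, 'm) cat" (structure)
    and box_obj :: "'o \<Rightarrow> 'o \<Rightarrow> 'o"  (infixr \<open>\<box>\<close> 70)
    and box_arr :: "'m \<Rightarrow> 'm \<Rightarrow> 'm"  (infixr \<open>\<box>\<^sub>m\<close> 70)
    and e :: 'o
    and \<alpha> :: "'o \<Rightarrow> 'o \<Rightarrow> 'o \<Rightarrow> 'm"
    and lam :: "'o \<Rightarrow> 'm"
    and \<rho> :: "'o \<Rightarrow> 'm"
    and \<tau> :: "'o \<Rightarrow> 'o \<Rightarrow> 'm"
    and \<gamma> :: "'o \<Rightarrow> 'o \<Rightarrow> 'o \<Rightarrow> 'm"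
  assumes "symmetric_monoidal_category C box_obj box_arr e \<alpha> lam \<rho> \<tau> \<gamma>"
  shows "\<forall>x \<in> Obj C. \<forall>y \<in> Obj C. \<forall>z \<in> Obj C. \<forall>t \<in> Obj C.
    \<comment> \<open>K1\<close> lam (x \<box> y) \<cdot> \<alpha> e x y = lam x \<box>\<^sub>m \<one> y \<and>
    \<comment> \<open>K2\<close> (\<one> x \<box>\<^sub>m \<rho> y) \<cdot> \<alpha> x y e = \<rho> (x \<box> y) \<and>
    \<comment> \<open>K3\<close> lam e = \<rho> e \<and>
    \<comment> \<open>K4\<close> (\<one> y \<box>\<^sub>m \<alpha> x z t) \<cdot> \<alpha> y (x \<box> z) t \<cdot> (\<gamma> x y z \<box>\<^sub>m \<one> t)
             = \<gamma> x y (z \<box> t) \<cdot> (\<one> x \<box>\<^sub>m \<alpha> y z t) \<cdot> \<alpha> x (y \<box> z) t \<and>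
    \<comment> \<open>K5\<close> (\<one> y \<box>\<^sub>m \<rho> x) \<cdot> \<gamma> x y e = \<tau> x y \<cdot> (\<one> x \<box>\<^sub>m \<rho> y) \<and>
    \<comment> \<open>W1\<close> \<rho> x \<cdot> \<tau> e x = lam x \<and>
    \<comment> \<open>W2\<close> lam x \<cdot> \<tau> x e = \<rho> x \<and>
    \<comment> \<open>W3\<close> lam (x \<box> y) \<cdot> \<gamma> x e y = \<one> x \<box>\<^sub>m lam y \<and>
    \<comment> \<open>W4\<close> (\<one> x \<box>\<^sub>m lam y) \<cdot> \<gamma> e x y = lam (x \<box> y) \<and>
    \<comment> \<open>W5\<close> \<gamma> y x z \<cdot> \<gamma> x y z = \<one> (x \<box> (y \<box> z)) \<and>
    \<comment> \<open>W6\<close> \<gamma> y x z \<cdot> \<tau> (x \<box> z) y = (\<one> x \<box>\<^sub>m \<tau> z y) \<cdot> \<alpha> x z y \<and>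
    \<comment> \<open>W7\<close> \<alpha> x y (z \<box> t) \<cdot> \<gamma> z (x \<box> y) t
             = (\<one> x \<box>\<^sub>m \<gamma> z y t) \<cdot> \<gamma> z x (y \<box> t) \<cdot> (\<one> z \<box>\<^sub>m \<alpha> x y t) \<and>
    \<comment> \<open>W8\<close> \<gamma> y x (z \<box> t) \<cdot> (\<one> y \<box>\<^sub>m \<alpha> x z t) \<cdot> \<gamma> (x \<box> z) y t
             = (\<one> x \<box>\<^sub>m \<gamma> z y t) \<cdot> \<alpha> x z (y \<box> t) \<and>
    \<comment> \<open>W9\<close> \<gamma> y x z \<cdot> (\<one> y \<box>\<^sub>m \<tau> z x) \<cdot> \<gamma> z y x
             = (\<one> x \<box>\<^sub>m \<tau> z y) \<cdot> \<gamma> z x y \<cdot> (\<one> z \<box>\<^sub>m \<tau> y x) \<and>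
    \<comment> \<open>W10\<close> \<gamma> y x (z \<box> t) \<cdot> (\<one> y \<box>\<^sub>m \<gamma> z x t) \<cdot> \<gamma> z y (x \<box> t)
             = (\<one> x \<box>\<^sub>m \<gamma> z y t) \<cdot> \<gamma> z x (y \<box> t) \<cdot> (\<one> z \<box>\<^sub>m \<gamma> y x t) \<and>
    \<comment> \<open>W11\<close> \<gamma> y x z \<cdot> (\<one> y \<box>\<^sub>m \<tau> z x) \<cdot> \<alpha> y z x = \<tau> (y \<box> z) x \<and>
    \<comment> \<open>W12\<close> \<gamma> y x (z \<box> t) \<cdot> (\<one> y \<box>\<^sub>m \<gamma> z x t) \<cdot> \<alpha> y z (x \<box> t)
             = (\<one> x \<box>\<^sub>m \<alpha> y z t) \<cdot> \<gamma> (y \<box> z) x t"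
proof -
  interpret symmetric_monoidal_category C box_obj box_arr e \<alpha> lam \<rho> \<tau> \<gamma>
    by (fact assms)
  show ?thesis
    \<comment> \<open>\<open>assoc\<close> brings the left-nested composites of the statement to the
      right-nested form of the lemmas.\<close>
    by (intro ballI conjI)
      (simp_all add: assoc lam_alpha rho_alpha lam_unit alpha_gamma rho_gamma rho_tau lam_tau
        lam_gamma lam_gamma_unit gamma_gamma gamma_tau alpha_gamma_box gamma_alpha_gamma
        yang_baxter_tau yang_baxter_gamma gamma_tau_alpha gamma_gamma_alpha)
qed

end
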